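(* For all integers $m \ge 0$, $n \ge 1$, $k \ge 0$, the $m$-nested summation $S^{(m)}(n,k)$ of the $k$-th power of the first $n$ natural numbers is given by $$S^{(m)}(n,k) = \sum_{i=0}^{k} \binom{n+m-1}{m+i}\, \mu(k,i).$$
   Context: Nested summation: for integers $m \ge 0$, $n \ge 1$, $k \ge 0$, define $S^{(m)}(n,k)$ (written $\sum^{(m)} n^k$ in the source) recursively by $S^{(0)}(n,k) = n^k$ and, for $m \ge 1$, $S^{(m)}(n,k) = \sum_{j=1}^{n} S^{(m-1)}(j,k)$. Saras triangle: for integers $k \ge 0$, $r \ge 0$, define $\mu(k,r)$ (the entry in row $k$, column $r$, both numbered from $0$) by $\mu(k,r) = 1$ if $r = 0$; $\mu(k,r) = r\,\mu(k-1,r-1) + (r+1)\,\mu(k-1,r)$ if $1 \le r \le k$; and $\mu(k,r) = 0$ if $r > k$. Binomial coefficients $\binom{a}{b}$ with integers $0 \le a < b$ are $0$. *)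

theory Defs
  imports Main
begin

fun nested_sum :: "nat \<Rightarrow> nat \<Rightarrow> nat \<Rightarrow> nat" where
  "nested_sum 0 n k = n ^ k"
| "nested_sum (Suc m) n k = (\<Sum>j = 1..n. nested_sum m j k)"

fun saras :: "nat \<Rightarrow> nat \<Rightarrow> nat" where
  "saras k 0 = 1"
| "saras 0 (Suc r) = 0"
| "saras (Suc k) (Suc r) =
     (if Suc r \<le> Suc k then Suc r * saras k r + (Suc r + 1) * saras k (Suc r) else 0)"

lemma saras_rec:
  assumes "1 \<le> r" "r \<le> k"
  shows "saras k r = r * saras (k - 1) (r - 1) + (r + 1) * saras (k - 1) r"
proof -
  obtain r' where "r = Suc r'"
    using assms by (cases r) auto
  moreover obtain k' where "k = Suc k'"
    using assms by (cases k) auto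
  ultimately show ?thesis
    using assms by simp
qed

lemma saras_eq_0:
  assumes "r > k"
  shows "saras k r = 0"
  using assms by (cases k; cases r) auto

end

(* With N = n - 1, absorption gives n * C(N, i) = (i + 1) * (C(N, i) + C(N, i + 1)), so multiplying
   an expansion of n^k in the basis C(N, i) by n transforms its coefficients exactly by the Saras
   recursion. Each further summation then shifts the binomials by the hockey-stick identity. *)
theory Submission
  imports Defs
begin

lemma saras_Suc_Suc:
  "saras (Suc k) (Suc r) = Suc r * saras k r + (r + 2) * saras k (Suc r)"
  by (simp add: saras_eq_0)

lemma Suc_times_choose:
  "Suc N * (N choose i) = Suc i * (N choose i) + Suc i * (N choose Suc i)"
  by (metis Suc_times_binomial_eq binomial_Suc_Suc distrib_left mult.commute)

lemma Suc_power_eq_sum_saras: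
  "Suc N ^ k = (\<Sum>i\<le>k. (N choose i) * saras k i)"
proof (induction k)
  case 0
  show ?case by simp
next
  case (Suc k)
  have "Suc N ^ Suc k = (\<Sum>i\<le>k. (Suc N * (N choose i)) * saras k i)"
    by (simp only: power_Suc Suc.IH sum_distrib_left mult.assoc)
  also have "\<dots> = (\<Sum>i\<le>k. Suc i * (N choose i) * saras k i)
      + (\<Sum>i\<le>k. Suc i * (N choose Suc i) * saras k i)"
    by (simp only: Suc_times_choose distrib_right sum.distrib)
  \<comment> \<open>The added term is zero because \<open>saras k (Suc k) = 0\<close>. Splitting off
    \<open>i = 0\<close> next leaves a sum over \<open>i \<le> k\<close> in the same binomials
    \<open>N choose Suc i\<close> as the other sum.\<close>
  also have "(\<Sum>i\<le>k. Suc i * (N choose i) * saras k i)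
      = (\<Sum>i\<le>Suc k. Suc i * (N choose i) * saras k i)"
    by (simp add: saras_eq_0)
  also have "\<dots> = 1 + (\<Sum>i\<le>k. (i + 2) * (N choose Suc i) * saras k (Suc i))"
    by (simp add: sum.atMost_Suc_shift del: sum.atMost_Suc)
  also have "\<dots> + (\<Sum>i\<le>k. Suc i * (N choose Suc i) * saras k i)
      = 1 + (\<Sum>i\<le>k. (N choose Suc i) * saras (Suc k) (Suc i))"
    unfolding saras_Suc_Suc add.assoc sum.distrib [symmetric]
    by (simp add: algebra_simps)
  also have "\<dots> = (\<Sum>i\<le>Suc k. (N choose i) * saras (Suc k) i)"
    by (simp only: sum.atMost_Suc_shift binomial_n_0 saras.simps(1) mult_1)
  finally show ?case .
qed

text \<open>Hockey-stick identity; the terms with \<open>j < i\<close> vanish, so the sum may start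
  at 0.\<close>

lemma sum_shifted_choose:
  "(\<Sum>j\<le>N. (j + m) choose (m + i)) = Suc (N + m) choose Suc (m + i)"
  by (induction N) (cases "i = 0", simp_all)

lemma nested_sum_Suc_eq:
  "nested_sum m (Suc N) k = (\<Sum>i\<le>k. ((N + m) choose (m + i)) * saras k i)"
\<comment> \<open>The outer sum needs the hypothesis at every \<open>j \<le> N\<close>, so
  \<open>N\<close> must vary.\<close>
proof (induction m arbitrary: N)
  case 0
  show ?case by (simp add: Suc_power_eq_sum_saras del: power_Suc)
next
  case (Suc m)
  have "nested_sum (Suc m) (Suc N) k = (\<Sum>j\<le>N. nested_sum m (Suc j) k)"
    by (simp only: nested_sum.simps One_nat_def sum.shift_bounds_cl_Suc_ivl atLeast0AtMost)
  also have "\<dots> = (\<Sum>i\<le>k. (\<Sum>j\<le>N. (j + m) choose (m + i)) * saras k i)"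
    unfolding Suc.IH sum_distrib_right by (rule sum.swap)
  finally show ?case
    by (simp only: sum_shifted_choose add_Suc add_Suc_right)
qed

theorem mainTheorem1:
  fixes m n k :: nat
  assumes "n \<ge> 1"
  shows "nested_sum m n k = (\<Sum>i = 0..k. ((n + m - 1) choose (m + i)) * saras k i)"
  using assms by (cases n) (simp_all add: nested_sum_Suc_eq atLeast0AtMost)

end
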